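(* Let $n\in\mathbb{N}$, let $g$ be a trading cost function, let $G$ be its Legendre transform in the last variable, and let $F_n=F(\mathcal{W}_n(S^{(n)}))$ be the claim, all as described in the context. Let $\mathcal{Q}_n$ be the set of all probability measures on $(\Omega,\mathcal{F}_n)$. Then the super-replication cost $V_n=V_n(g,F_n)$ satisfies $$ V_n=\sup_{\mathbb{P}\in \mathcal{Q}_n}\mathbb{E}^{\mathbb{P}}\left[F_n-\sum_{k=0}^{n-1}G\left(\frac{k}{n},\,\mathcal{W}_n(S^{(n)}),\,\mathbb{E}^{\mathbb{P}}\left[S^{(n)}(n)\,|\,\mathcal{F}_k\right]-S^{(n)}(k)\right)\right], $$ where $\mathbb{E}^{\mathbb{P}}$ denotes expectation with respect to $\mathbb{P}$.
   Context: Probability space: $\Omega=\{-1,1\}^\infty$ with the product measure $\mathbb{Q}=\{\tfrac12,\tfrac12\}^\infty$; $\xi_i(\omega)=\omega_i$; $\mathcal{F}_k=\sigma\{\xi_1,\dots,\xi_k\}$ for $k\ge1$, and $\mathcal{F}_0$ is trivial. Path spaces: $\mathcal{C}[0,1]$ is the space of continuous functions on $[0,1]$ with the uniform norm $\|\cdot\|_\infty$; $\mathcal{C}^+[0,1]$ is the subset of strictly positive functions. Stock price: for constants $\sigma>0$, $s_0>0$, $S^{(n)}(k)=s_0\exp\left(\sigma n^{-1/2}\sum_{i=1}^k\xi_i\right)$, $k=0,\dots,n$. Interpolation: $\mathcal{W}_n:\mathbb{R}^{n+1}\to\mathcal{C}[0,1]$, $\mathcal{W}_n(y)(t)=([nt]+1-nt)\,y([nt])+(nt-[nt])\,y([nt]+1)$,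 where $[z]$ is the integer part (at $t=1$ the value is $y(n)$). Claim: $F:\mathcal{C}[0,1]\to\mathbb{R}_+$ is continuous and there are constants $C,p>0$ with $F(y)\le C(1+\|y\|_\infty^p)$ for all $y$. Set $F_n:=F(\mathcal{W}_n(S^{(n)}))$. Trading cost function: $g:[0,1]\times\mathcal{C}^+[0,1]\times\mathbb{R}\to[0,\infty)$ with $g(t,S,0)=0$, $g(t,S,\cdot)$ convex for every $(t,S)$, and $g$ adapted: $g(t,S,\nu)=g(t,\hat S,\nu)$ whenever $S(s)=\hat S(s)$ for all $s\le t$. Its Legendre transform is $G(t,S,y)=\sup_{\nu\in\mathbb{R}}(\nu y-g(t,S,\nu))\in[0,\infty]$. Portfolios: a self-financing portfolio with initial capital $x$ is a pair $\pi=(x,\{\gamma(k)\}_{k=0}^n)$ with $\gamma(0)=0$ and $\gamma(k)$ real-valued and $\mathcal{F}_{k-1}$-measurable for $k\ge1$; $\mathcal{A}_n(x)$ is the set of all such portfolios. Its value is defined by $Y^\pi(0)=x$ and, for $k=0,\dots,n-1$, $$Y^\pi(k+1)=Y^\pi(k)+\gamma(k+1)\left(S^{(n)}(k+1)-S^{(n)}(k)\right)-g\left(\tfrac{k}{n},\mathcal{W}_n(S^{(n)}),\gamma(k+1)-\gamma(k)\right).$$ Super-replication cost: $V_n=V_n(g,F_n)=\inf\{x\mid \exists\,\pi\in\mathcal{A}_n(x)\text{ such that }Y^\pi(n)\ge F_n\ \mathbb{Q}\text{-a.s.}\}$. *)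

theory Defs
  imports "HOL-Probability.Probability"
begin

section \<open>The coin-tossing space\<close>

text \<open>Outcomes are sequences indexed by \<open>{1..}\<close>; elements of \<^term>\<open>coin_outcomes\<close> are extensional,
  so the unused coordinate \<open>0\<close> of the type \<^typ>\<open>nat \<Rightarrow> real\<close> carries no information.\<close>

definition coin_outcomes :: "(nat \<Rightarrow> real) set" where
  "coin_outcomes = {1..} \<rightarrow>\<^sub>E {-1, 1}"

definition coin_measure :: "(nat \<Rightarrow> real) measure" where
  "coin_measure = (\<Pi>\<^sub>M i\<in>{1..}. uniform_count_measure {-1, 1})"

definition \<xi> :: "nat \<Rightarrow> (nat \<Rightarrow> real) \<Rightarrow> real" where
  "\<xi> i \<omega> = \<omega> i"

text \<open>As a measure, \<^term>\<open>coin_filtration k\<close> only carries the \<open>\<sigma>\<close>-algebra generated by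
  \<open>\<xi>\<^sub>1, \<dots>, \<xi>\<^sub>k\<close>. For \<open>k = 0\<close> there are no generators and it is the trivial \<open>\<sigma>\<close>-algebra.\<close>

definition coin_filtration :: "nat \<Rightarrow> (nat \<Rightarrow> real) measure" where
  "coin_filtration k =
     sigma coin_outcomes {\<xi> i -` A \<inter> coin_outcomes | i A. i \<in> {1..k} \<and> A \<in> sets borel}"

section \<open>Path spaces\<close>

text \<open>Paths are functions on \<open>[0,1]\<close>, represented as extensional functions (undefined outside
  \<open>[0,1]\<close>), as in the library's space of continuous functions with the uniform metric.\<close>

definition path_metric :: "(real \<Rightarrow> real) metric" where
  "path_metric = cfunspace (top_of_set {0..1}) euclidean_metric"

abbreviation paths :: "(real \<Rightarrow> real) set" where
  "paths \<equiv> mspace path_metric"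

definition positive_paths :: "(real \<Rightarrow> real) set" where
  "positive_paths = {S \<in> paths. \<forall>t\<in>{0..1}. S t > 0}"

definition path_norm :: "(real \<Rightarrow> real) \<Rightarrow> real" where
  "path_norm y = (SUP t\<in>{0..1}. \<bar>y t\<bar>)"

text \<open>A vector in \<open>\<real>\<^sup>n\<^sup>+\<^sup>1\<close> is given by the values of \<^term>\<open>y\<close> at \<open>0, \<dots>, n\<close>. At \<open>t = 1\<close> the value
  \<open>y (n + 1)\<close> is multiplied by \<open>0\<close>, so the result does not depend on it.\<close>

definition interpolation :: "nat \<Rightarrow> (nat \<Rightarrow> real) \<Rightarrow> real \<Rightarrow> real" where
  "interpolation n y =
     (\<lambda>t\<in>{0..1}. (of_int \<lfloor>real n * t\<rfloor> + 1 - real n * t) * y (nat \<lfloor>real n * t\<rfloor>)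
              + (real n * t - of_int \<lfloor>real n * t\<rfloor>) * y (nat \<lfloor>real n * t\<rfloor> + 1))"

section \<open>Market model\<close>

definition stock :: "real \<Rightarrow> real \<Rightarrow> nat \<Rightarrow> nat \<Rightarrow> (nat \<Rightarrow> real) \<Rightarrow> real" where
  "stock \<sigma> s0 n k \<omega> = s0 * exp (\<sigma> * real n powr (-1/2) * (\<Sum>i=1..k. \<xi> i \<omega>))"

definition stock_path :: "real \<Rightarrow> real \<Rightarrow> nat \<Rightarrow> (nat \<Rightarrow> real) \<Rightarrow> real \<Rightarrow> real" where
  "stock_path \<sigma> s0 n \<omega> = interpolation n (\<lambda>k. stock \<sigma> s0 n k \<omega>)"

definition admissible_claim :: "((real \<Rightarrow> real) \<Rightarrow> real) \<Rightarrow> bool" where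
  "admissible_claim F \<longleftrightarrow>
     continuous_map (mtopology_of path_metric) (top_of_set {0..}) F \<and>
     (\<exists>C>0. \<exists>p>0. \<forall>y\<in>paths. F y \<le> C * (1 + path_norm y powr p))"

definition trading_cost :: "(real \<Rightarrow> (real \<Rightarrow> real) \<Rightarrow> real \<Rightarrow> real) \<Rightarrow> bool" where
  "trading_cost g \<longleftrightarrow>
     (\<forall>t\<in>{0..1}. \<forall>S\<in>positive_paths.
        (\<forall>\<nu>. g t S \<nu> \<ge> 0) \<and> g t S 0 = 0 \<and> convex_on UNIV (g t S)) \<and>
     (\<forall>t\<in>{0..1}. \<forall>S\<in>positive_paths. \<forall>S'\<in>positive_paths.
        (\<forall>s\<in>{0..t}. S s = S' s) \<longrightarrow> (\<forall>\<nu>. g t S \<nu> = g t S' \<nu>))"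

definition legendre ::
  "(real \<Rightarrow> (real \<Rightarrow> real) \<Rightarrow> real \<Rightarrow> real) \<Rightarrow> real \<Rightarrow> (real \<Rightarrow> real) \<Rightarrow> real \<Rightarrow> ereal" where
  "legendre g t S y = (SUP \<nu>. ereal (\<nu> * y - g t S \<nu>))"

section \<open>Portfolios and super-replication\<close>

type_synonym portfolio = "real \<times> (nat \<Rightarrow> (nat \<Rightarrow> real) \<Rightarrow> real)"

text \<open>Only \<open>\<gamma>(0), \<dots>, \<gamma>(n)\<close> are constrained; later values of \<open>\<gamma>\<close> are never used.\<close>

definition portfolios :: "nat \<Rightarrow> real \<Rightarrow> portfolio set" where
  "portfolios n x =
     {(x, \<gamma>) | \<gamma>. (\<forall>\<omega>\<in>coin_outcomes. \<gamma> 0 \<omega> = 0) \<and>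
                  (\<forall>k\<in>{1..n}. \<gamma> k \<in> borel_measurable (coin_filtration (k - 1)))}"

primrec portfolio_value ::
  "real \<Rightarrow> real \<Rightarrow> nat \<Rightarrow> (real \<Rightarrow> (real \<Rightarrow> real) \<Rightarrow> real \<Rightarrow> real) \<Rightarrow> portfolio \<Rightarrow>
   nat \<Rightarrow> (nat \<Rightarrow> real) \<Rightarrow> real" where
  "portfolio_value \<sigma> s0 n g \<pi> 0 \<omega> = fst \<pi>"
| "portfolio_value \<sigma> s0 n g \<pi> (Suc k) \<omega> =
     portfolio_value \<sigma> s0 n g \<pi> k \<omega>
     + snd \<pi> (Suc k) \<omega> * (stock \<sigma> s0 n (Suc k) \<omega> - stock \<sigma> s0 n k \<omega>)
     - g (real k / real n) (stock_path \<sigma> s0 n \<omega>) (snd \<pi> (Suc k) \<omega> - snd \<pi> k \<omega>)"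

text \<open>The infimum is taken in the extended reals, so that no junk value can arise from an empty or
  unbounded set of initial capitals.\<close>

definition super_replication_cost ::
  "real \<Rightarrow> real \<Rightarrow> nat \<Rightarrow> (real \<Rightarrow> (real \<Rightarrow> real) \<Rightarrow> real \<Rightarrow> real) \<Rightarrow> ((nat \<Rightarrow> real) \<Rightarrow> real) \<Rightarrow> ereal"
where
  "super_replication_cost \<sigma> s0 n g X =
     Inf {ereal x | x. \<exists>\<pi>\<in>portfolios n x.
            AE \<omega> in coin_measure. portfolio_value \<sigma> s0 n g \<pi> n \<omega> \<ge> X \<omega>}"

section \<open>Probability measures and extended expectation\<close>

definition prob_measures :: "nat \<Rightarrow> (nat \<Rightarrow> real) measure set" where
  "prob_measures n = {P. prob_space P \<and> sets P = sets (coin_filtration n)}"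

text \<open>The Legendre transform may be infinite with positive probability, so the expectation has to
  be taken in the extended sense \<open>E[X\<^sup>+] - E[X\<^sup>-]\<close>, which is meaningful as soon as one of the two
  terms is finite; \<^const>\<open>e2ennreal\<close> maps \<open>x\<close> to \<open>max 0 x\<close>.\<close>

definition expectation_ereal :: "'a measure \<Rightarrow> ('a \<Rightarrow> ereal) \<Rightarrow> ereal" where
  "expectation_ereal M X =
     enn2ereal (\<integral>\<^sup>+ \<omega>. e2ennreal (X \<omega>) \<partial>M) - enn2ereal (\<integral>\<^sup>+ \<omega>. e2ennreal (- X \<omega>) \<partial>M)"

end

theory Submission
  imports Defs
begin

text \<open>In terms of the trades \<open>\<delta>\<^sub>k = \<gamma>(k+1) - \<gamma>(k)\<close>, summation by parts turns the terminal wealth into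
  \<open>x + \<Sum>\<^sub>k \<delta>\<^sub>k (S(n) - S(k)) - g(k/n, \<delta>\<^sub>k)\<close>, which is concave in \<open>\<delta>\<close>. There are only finitely many
  scenarios, so the super-replication cost is the infimum over \<open>\<delta>\<close> of a maximum of finitely many
  convex functions, and the minimax theorem for the simplex of probability vectors needs no
  constraint qualification. Under a fixed measure \<open>S(n)\<close> may be replaced by its conditional
  expectation, and since \<open>g\<close> is adapted the optimisation over \<open>\<delta>\<^sub>k\<close> is pointwise, producing \<open>G\<close>.\<close>

section \<open>Minimax for finitely many convexlike functions\<close>

text \<open>The pairs dominating some \<open>(f1 x, f2 x)\<close> form a convex set that misses the
  open negative quadrant. A line separating the two sets has a normal with nonnegative coordinates;
  dividing it by their sum yields the weights \<open>1 - t\<close> and \<open>t\<close>.\<close>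

lemma convexlike_minimax_two:
  fixes f1 f2 :: "'x \<Rightarrow> real"
  assumes convexlike: "\<And>x y t. x \<in> X \<Longrightarrow> y \<in> X \<Longrightarrow> 0 \<le> t \<Longrightarrow> t \<le> 1 \<Longrightarrow>
      \<exists>z\<in>X. f1 z \<le> (1 - t) * f1 x + t * f1 y \<and> f2 z \<le> (1 - t) * f2 x + t * f2 y"
    and nonneg: "\<And>x. x \<in> X \<Longrightarrow> 0 \<le> f1 x \<or> 0 \<le> f2 x"
  shows "\<exists>t\<ge>0. t \<le> 1 \<and> (\<forall>x\<in>X. 0 \<le> (1 - t) * f1 x + t * f2 x)"
proof (cases "X = {}")
  case False
  define K where "K = {(a, b). \<exists>x\<in>X. f1 x \<le> a \<and> f2 x \<le> b}"
  define N :: "(real \<times> real) set" where "N = {..<0} \<times> {..<0}"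
  have "convex K"
    unfolding convex_alt
  proof (clarsimp simp: K_def)
    fix a b a' b' x y and t :: real
    assume *: "x \<in> X" "f1 x \<le> a" "f2 x \<le> b" "y \<in> X" "f1 y \<le> a'" "f2 y \<le> b'" "0 \<le> t" "t \<le> 1"
    then obtain z where z: "z \<in> X" "f1 z \<le> (1 - t) * f1 x + t * f1 y" "f2 z \<le> (1 - t) * f2 x + t * f2 y"
      using convexlike by blast
    have "(1 - t) * f1 x + t * f1 y \<le> (1 - t) * a + t * a'"
      "(1 - t) * f2 x + t * f2 y \<le> (1 - t) * b + t * b'"
      using * by (auto intro!: add_mono mult_left_mono)
    with z show "\<exists>x\<in>X. f1 x \<le> (1 - t) * a + t * a' \<and> f2 x \<le> (1 - t) * b + t * b'"
      by (intro bexI[of _ z]) auto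
  qed
  moreover have "convex N"
    unfolding N_def by (intro convex_Times convex_real_interval)
  moreover have "(-1, -1) \<in> N" by (simp add: N_def)
  moreover have "K \<noteq> {}" using False unfolding K_def by fastforce
  moreover have "N \<inter> K = {}" using nonneg unfolding N_def K_def by fastforce
  ultimately obtain c d where cd: "c \<noteq> 0" "\<forall>w\<in>N. inner c w \<le> d" "\<forall>w\<in>K. inner c w \<ge> d"
    using separating_hyperplane_sets[of N K] by blast
  obtain a b where c: "c = (a, b)" by fastforce
  have N: "a * u + b * v \<le> d" if "u < 0" "v < 0" for u v
    using cd(2) that by (force simp: N_def c)
  have K: "d \<le> a * f1 x + b * f2 x" if "x \<in> X" for x
    using cd(3) that by (force simp: K_def c)
  have d: "d \<ge> 0"
  proof (rule ccontr)
    assume "\<not> d \<ge> 0"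
    \<comment> \<open>\<open>e\<close> is so small that the functional at \<open>(-e, -e)\<close> is
      at least \<open>d / 2\<close>, which exceeds \<open>d\<close> when \<open>d\<close> is
      negative.\<close>
    define e where "e = - d / (2 * (\<bar>a\<bar> + \<bar>b\<bar> + 1))"
    have "e > 0" using \<open>\<not> d \<ge> 0\<close> unfolding e_def by (intro divide_pos_pos) auto
    then have "(a + b) * e \<ge> - d" using N[of "-e" "-e"] by (simp add: algebra_simps)
    moreover have "(a + b) * e \<le> (\<bar>a\<bar> + \<bar>b\<bar> + 1) * e"
      using \<open>e > 0\<close> by (intro mult_right_mono) auto
    moreover have "(\<bar>a\<bar> + \<bar>b\<bar> + 1) * e = - d / 2"
      by (simp add: e_def field_simps)
    ultimately show False using \<open>\<not> d \<ge> 0\<close> by simp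
  qed
  have nonneg_coeff: "a \<ge> 0" "b \<ge> 0"
  proof -
    show "a \<ge> 0"
    proof (rule ccontr)
      assume "\<not> a \<ge> 0"
      \<comment> \<open>For negative \<open>a\<close> this point lies in \<open>N\<close>, and the
        functional exceeds \<open>d\<close> there because \<open>\<bar>b\<bar> + 1\<close> outweighs
        \<open>b\<close>.\<close>
      then have "a * ((d + \<bar>b\<bar> + 1) / a) + b * (-1) \<le> d"
        using d by (intro N) (auto simp: divide_pos_neg)
      then show False using \<open>\<not> a \<ge> 0\<close> by simp
    qed
    show "b \<ge> 0"
    proof (rule ccontr)
      assume "\<not> b \<ge> 0"
      then have "a * (-1) + b * ((d + \<bar>a\<bar> + 1) / b) \<le> d"
        using d by (intro N) (auto simp: divide_pos_neg)
      then show False using \<open>\<not> b \<ge> 0\<close> by simp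
    qed
  qed
  have "a + b > 0"
    using cd(1) nonneg_coeff by (auto simp: c zero_prod_def)
  define t where "t = b / (a + b)"
  have t: "1 - t = a / (a + b)" "0 \<le> t" "t \<le> 1"
    using \<open>a + b > 0\<close> nonneg_coeff by (auto simp: t_def field_simps)
  have "0 \<le> (1 - t) * f1 x + t * f2 x" if "x \<in> X" for x
  proof -
    have "(1 - t) * f1 x + t * f2 x = (a * f1 x + b * f2 x) / (a + b)"
      unfolding t(1) by (simp add: t_def add_divide_distrib)
    then show ?thesis using K[OF that] d \<open>a + b > 0\<close> by simp
  qed
  with t show ?thesis by blast
qed auto

text \<open>Fan's minimax theorem for a finite family of convexlike functions. The inductive step applies
  the hypothesis on the subset where the new function is negative, which is again convexlike.\<close>

lemma convexlike_minimax:
  fixes f :: "'i \<Rightarrow> 'x \<Rightarrow> real"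
  assumes "finite I" "I \<noteq> {}"
    and "\<And>x y t. x \<in> X \<Longrightarrow> y \<in> X \<Longrightarrow> 0 \<le> t \<Longrightarrow> t \<le> 1 \<Longrightarrow>
      \<exists>z\<in>X. \<forall>i\<in>I. f i z \<le> (1 - t) * f i x + t * f i y"
    and "\<And>x. x \<in> X \<Longrightarrow> \<exists>i\<in>I. 0 \<le> f i x"
  shows "\<exists>p. (\<forall>i\<in>I. 0 \<le> p i) \<and> sum p I = 1 \<and> (\<forall>x\<in>X. 0 \<le> (\<Sum>i\<in>I. p i * f i x))"
  using assms
proof (induction I arbitrary: X rule: finite_ne_induct)
  case (singleton i)
  then show ?case by (intro exI[of _ "\<lambda>_. 1"]) auto
next
  case (insert j I)
  define Y where "Y = {x \<in> X. f j x < 0}"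
  have "\<exists>p. (\<forall>i\<in>I. 0 \<le> p i) \<and> sum p I = 1 \<and> (\<forall>x\<in>Y. 0 \<le> (\<Sum>i\<in>I. p i * f i x))"
  proof (rule insert.IH)
    fix x y and t :: real assume *: "x \<in> Y" "y \<in> Y" "0 \<le> t" "t \<le> 1"
    then obtain z where z: "z \<in> X" "\<forall>i\<in>insert j I. f i z \<le> (1 - t) * f i x + t * f i y"
      using insert.prems(1)[of x y t] by (auto simp: Y_def)
    \<comment> \<open>This keeps \<open>z\<close> inside \<open>Y\<close>. Strictness comes from
      \<open>x\<close> if \<open>t = 0\<close> and from \<open>y\<close> otherwise.\<close>
    have "(1 - t) * f j x + t * f j y < 0"
    proof (cases "t = 0")
      case False
      have "(1 - t) * f j x \<le> 0" "t * f j y < 0"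
        using * False by (auto simp: Y_def mult_le_0_iff mult_less_0_iff)
      then show ?thesis by simp
    qed (use * in \<open>simp add: Y_def\<close>)
    with z show "\<exists>z\<in>Y. \<forall>i\<in>I. f i z \<le> (1 - t) * f i x + t * f i y"
      by (intro bexI[of _ z]) (auto simp: Y_def intro: le_less_trans)
  next
    fix x assume "x \<in> Y"
    then show "\<exists>i\<in>I. 0 \<le> f i x"
      using insert.prems(2)[of x] by (auto simp: Y_def)
  qed
  then obtain p where p: "\<forall>i\<in>I. 0 \<le> p i" "sum p I = 1" "\<forall>x\<in>Y. 0 \<le> (\<Sum>i\<in>I. p i * f i x)"
    by blast
  \<comment> \<open>Off \<open>Y\<close> the function \<open>f j\<close> is nonnegative, and on
    \<open>Y\<close> the \<open>p\<close>-mixture of the others is, so the case of two functions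
    applies to this pair.\<close>
  have "\<exists>t\<ge>0. t \<le> 1 \<and> (\<forall>x\<in>X. 0 \<le> (1 - t) * f j x + t * (\<Sum>i\<in>I. p i * f i x))"
  proof (rule convexlike_minimax_two)
    fix x y and t :: real assume "x \<in> X" "y \<in> X" "0 \<le> t" "t \<le> 1"
    then obtain z where z: "z \<in> X" "\<forall>i\<in>insert j I. f i z \<le> (1 - t) * f i x + t * f i y"
      using insert.prems(1)[of x y t] by blast
    have "(\<Sum>i\<in>I. p i * f i z) \<le> (\<Sum>i\<in>I. p i * ((1 - t) * f i x + t * f i y))"
      using z p by (intro sum_mono mult_left_mono) auto
    also have "\<dots> = (1 - t) * (\<Sum>i\<in>I. p i * f i x) + t * (\<Sum>i\<in>I. p i * f i y)"
      by (simp add: sum_distrib_left sum.distrib[symmetric] algebra_simps)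
    finally show "\<exists>z\<in>X. f j z \<le> (1 - t) * f j x + t * f j y \<and>
        (\<Sum>i\<in>I. p i * f i z) \<le> (1 - t) * (\<Sum>i\<in>I. p i * f i x) + t * (\<Sum>i\<in>I. p i * f i y)"
      using z by blast
  next
    fix x assume "x \<in> X"
    then show "0 \<le> f j x \<or> 0 \<le> (\<Sum>i\<in>I. p i * f i x)"
      using p(3) by (auto simp: Y_def not_le)
  qed
  then obtain t where t: "0 \<le> t" "t \<le> 1" "\<forall>x\<in>X. 0 \<le> (1 - t) * f j x + t * (\<Sum>i\<in>I. p i * f i x)"
    by blast
  define q where "q i = (if i = j then 1 - t else t * p i)" for i
  have q: "(\<Sum>i\<in>insert j I. q i * h i) = (1 - t) * h j + t * (\<Sum>i\<in>I. p i * h i)" for h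
  proof -
    have "(\<Sum>i\<in>I. q i * h i) = (\<Sum>i\<in>I. t * (p i * h i))"
      using \<open>j \<notin> I\<close> by (intro sum.cong) (auto simp: q_def)
    then show ?thesis
      using insert.hyps by (simp add: q_def sum_distrib_left)
  qed
  have "sum q (insert j I) = 1"
    using q[of "\<lambda>_. 1"] p(2) by simp
  then show ?case
    using q t p(1) by (intro exI[of _ q]) (auto simp: q_def)
qed

section \<open>Atoms of the coin filtration\<close>

text \<open>\<open>truncate k \<omega>\<close> is a canonical representative of the atom of \<open>\<F>\<^sub>k\<close> containing \<open>\<omega>\<close>, so that
  \<open>known_at k\<close> is \<open>\<F>\<^sub>k\<close>-measurability, without reference to a \<open>\<sigma>\<close>-algebra on the target.\<close>

definition truncate :: "nat \<Rightarrow> (nat \<Rightarrow> real) \<Rightarrow> nat \<Rightarrow> real" where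
  "truncate k \<omega> = (\<lambda>i\<in>{1..}. if i \<le> k then \<omega> i else 1)"

definition known_at :: "nat \<Rightarrow> ((nat \<Rightarrow> real) \<Rightarrow> 'a) \<Rightarrow> bool" where
  "known_at k f \<longleftrightarrow> (\<forall>\<omega>\<in>coin_outcomes. f (truncate k \<omega>) = f \<omega>)"

lemma truncate_in_coin_outcomes [simp]: "\<omega> \<in> coin_outcomes \<Longrightarrow> truncate k \<omega> \<in> coin_outcomes"
  by (auto simp: truncate_def coin_outcomes_def PiE_iff)

lemma truncate_apply: "1 \<le> i \<Longrightarrow> i \<le> k \<Longrightarrow> truncate k \<omega> i = \<omega> i"
  by (simp add: truncate_def)

lemma truncate_truncate: "j \<le> k \<Longrightarrow> truncate j (truncate k \<omega>) = truncate j \<omega>"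
  by (auto simp: truncate_def fun_eq_iff)

lemma truncate_cong:
  "(\<And>i. 1 \<le> i \<Longrightarrow> i \<le> k \<Longrightarrow> \<omega> i = \<omega>' i) \<Longrightarrow> truncate k \<omega> = truncate k \<omega>'"
  by (auto simp: truncate_def fun_eq_iff)

lemma known_atI:
  "(\<And>\<omega> \<omega>'. \<omega> \<in> coin_outcomes \<Longrightarrow> \<omega>' \<in> coin_outcomes \<Longrightarrow> (\<And>i. 1 \<le> i \<Longrightarrow> i \<le> k \<Longrightarrow> \<omega> i = \<omega>' i) \<Longrightarrow> f \<omega> = f \<omega>')
    \<Longrightarrow> known_at k f"
  unfolding known_at_def by (metis truncate_in_coin_outcomes truncate_apply)

lemma known_atD: "known_at k f \<Longrightarrow> \<omega> \<in> coin_outcomes \<Longrightarrow> f (truncate k \<omega>) = f \<omega>"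
  by (simp add: known_at_def)

lemma known_at_mono: "known_at j f \<Longrightarrow> j \<le> k \<Longrightarrow> known_at k f"
  unfolding known_at_def by (metis truncate_in_coin_outcomes truncate_truncate)

text \<open>Truncation factors through the first \<open>k\<close> signs. This finiteness of the set
  of atoms is what later makes every expectation a finite sum and the minimax theorem
  applicable.\<close>

lemma finite_truncate_image: "finite (truncate k ` coin_outcomes)"
proof (rule finite_subset)
  have "finite ({1..k} \<rightarrow>\<^sub>E {-1, 1 :: real})" by (intro finite_PiE) auto
  then show "finite (truncate k ` ({1..k} \<rightarrow>\<^sub>E {-1, 1}))" by simp
  show "truncate k ` coin_outcomes \<subseteq> truncate k ` ({1..k} \<rightarrow>\<^sub>E {-1, 1})"
  proof (rule image_subsetI)
    fix \<omega> assume "\<omega> \<in> coin_outcomes"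
    then have "restrict \<omega> {1..k} \<in> {1..k} \<rightarrow>\<^sub>E {-1, 1}"
      by (auto simp: coin_outcomes_def PiE_iff)
    moreover have "truncate k \<omega> = truncate k (restrict \<omega> {1..k})"
      by (intro truncate_cong) simp
    ultimately show "truncate k \<omega> \<in> truncate k ` ({1..k} \<rightarrow>\<^sub>E {-1, 1})" by blast
  qed
qed

lemma space_coin_filtration [simp]: "space (coin_filtration k) = coin_outcomes"
  by (simp add: coin_filtration_def space_measure_of_conv)

lemma sets_coin_filtration: "sets (coin_filtration k) =
    sigma_sets coin_outcomes {\<xi> i -` A \<inter> coin_outcomes | i A. i \<in> {1..k} \<and> A \<in> sets borel}"
  unfolding coin_filtration_def by (intro sets_measure_of) auto

lemma subalgebra_coin_filtration:
  "space P = coin_outcomes \<Longrightarrow> sets P = sets (coin_filtration n) \<Longrightarrow> k \<le> n \<Longrightarrow>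
    subalgebra P (coin_filtration k)"
  unfolding subalgebra_def sets_coin_filtration space_coin_filtration
  by (intro conjI) (simp, simp, rule sigma_sets_mono', force)

text \<open>The generators of \<open>\<F>\<^sub>k\<close> constrain only coordinates that truncation
  preserves, and the property survives complements and countable unions.\<close>

lemma truncate_in_sets_iff:
  assumes "A \<in> sets (coin_filtration k)" "\<omega> \<in> coin_outcomes"
  shows "truncate k \<omega> \<in> A \<longleftrightarrow> \<omega> \<in> A"
  using assms(1) unfolding sets_coin_filtration
  by induction (use assms(2) in \<open>auto simp: \<xi>_def truncate_apply\<close>)

text \<open>Singletons are Borel in a T1 space, so the level set of \<open>f\<close> through
  \<omega> belongs to \<open>\<F>\<^sub>k\<close> and contains the truncation of \<omega> as
  well.\<close>

lemma measurable_coin_filtration_imp_known_at: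
  fixes f :: "(nat \<Rightarrow> real) \<Rightarrow> 'a::t1_space"
  assumes "f \<in> borel_measurable (coin_filtration k)"
  shows "known_at k f"
  unfolding known_at_def
proof
  fix \<omega> assume *: "\<omega> \<in> coin_outcomes"
  have "f -` {f \<omega>} \<inter> coin_outcomes \<in> sets (coin_filtration k)"
    using measurable_sets[OF assms, of "{f \<omega>}"] by simp
  from truncate_in_sets_iff[OF this *] * show "f (truncate k \<omega>) = f \<omega>" by simp
qed

text \<open>Each fibre is an atom of \<open>\<F>\<^sub>k\<close>, that is, a finite intersection of
  conditions on single coordinates.\<close>

lemma measurable_truncate:
  "truncate k \<in> measurable (coin_filtration k) (count_space (truncate k ` coin_outcomes))"
  unfolding measurable_count_space_eq2[OF finite_truncate_image]
proof (intro conjI ballI)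
  show "truncate k \<in> space (coin_filtration k) \<rightarrow> truncate k ` coin_outcomes" by simp
  fix b assume "b \<in> truncate k ` coin_outcomes"
  then obtain a where a: "a \<in> coin_outcomes" "b = truncate k a" by blast
  have "{\<omega> \<in> coin_outcomes. \<omega> i = a i} \<in> sets (coin_filtration k)" if "i \<in> {1..k}" for i
  proof -
    have "\<xi> i -` {a i} \<inter> coin_outcomes \<in> sets (coin_filtration k)"
      unfolding sets_coin_filtration using that by (intro sigma_sets.Basic CollectI exI[of _ i] exI[of _ "{a i}"]) simp
    moreover have "\<xi> i -` {a i} \<inter> coin_outcomes = {\<omega> \<in> coin_outcomes. \<omega> i = a i}"
      by (auto simp: \<xi>_def)
    ultimately show ?thesis by simp
  qed
  then have "{\<omega> \<in> space (coin_filtration k). \<forall>i\<in>{1..k}. \<omega> i = a i} \<in> sets (coin_filtration k)"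
    by (intro sets.sets_Collect_finite_All) auto
  moreover have "truncate k -` {truncate k a} \<inter> space (coin_filtration k) =
      {\<omega> \<in> space (coin_filtration k). \<forall>i\<in>{1..k}. \<omega> i = a i}"
  proof (intro set_eqI iffI)
    fix \<omega> assume \<omega>: "\<omega> \<in> truncate k -` {truncate k a} \<inter> space (coin_filtration k)"
    have "\<omega> i = a i" if "i \<in> {1..k}" for i
      using that \<omega> truncate_apply[of i k \<omega>] truncate_apply[of i k a] by simp
    with \<omega> show "\<omega> \<in> {\<omega> \<in> space (coin_filtration k). \<forall>i\<in>{1..k}. \<omega> i = a i}" by simp
  next
    fix \<omega> assume "\<omega> \<in> {\<omega> \<in> space (coin_filtration k). \<forall>i\<in>{1..k}. \<omega> i = a i}"
    then show "\<omega> \<in> truncate k -` {truncate k a} \<inter> space (coin_filtration k)"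
      by (auto intro!: truncate_cong)
  qed
  ultimately show "truncate k -` {b} \<inter> space (coin_filtration k) \<in> sets (coin_filtration k)"
    by (simp only: a(2))
qed

text \<open>Such an \<open>f\<close> factors through the finite discrete space of truncated
  outcomes, on which every map is measurable.\<close>

lemma known_at_imp_measurable:
  assumes "known_at k f" "\<And>\<omega>. \<omega> \<in> coin_outcomes \<Longrightarrow> f \<omega> \<in> space N"
  shows "f \<in> measurable (coin_filtration k) N"
proof -
  have "f \<in> measurable (count_space (truncate k ` coin_outcomes)) N"
    using assms(2) by auto
  from measurable_compose[OF measurable_truncate this]
  show ?thesis
    by (rule measurable_cong[THEN iffD1, rotated]) (simp add: known_atD[OF assms(1)])
qed

lemma borel_measurable_coin_filtration_iff:
  fixes f :: "(nat \<Rightarrow> real) \<Rightarrow> 'a::t1_space"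
  shows "f \<in> borel_measurable (coin_filtration k) \<longleftrightarrow> known_at k f"
  using measurable_coin_filtration_imp_known_at known_at_imp_measurable[of k f borel] by auto

lemma space_coin_measure: "space coin_measure = coin_outcomes"
  by (simp add: coin_measure_def space_PiM coin_outcomes_def space_uniform_count_measure)

text \<open>A failure at \<omega> would spread to the cylinder of all sequences agreeing with
  \<omega> up to \<open>n\<close>, which has mass \<open>(1/2)^n\<close> and so is not null.\<close>

lemma AE_coin_measure_known_at:
  assumes "AE \<omega> in coin_measure. Q \<omega>" and "known_at n Q" and "\<omega> \<in> coin_outcomes"
  shows "Q \<omega>"
proof (rule ccontr)
  assume "\<not> Q \<omega>"
  let ?M = "\<lambda>i::nat. uniform_count_measure {-1, 1 :: real}"
  have "prob_space (uniform_count_measure {-1, 1 :: real})"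
    by (rule prob_space_uniform_count_measure) simp_all
  then interpret product_prob_space ?M "{1..}"
    by (intro product_prob_spaceI)
  let ?C = "prod_emb {1..} ?M {1..n} (\<Pi>\<^sub>E i\<in>{1..n}. {\<omega> i})"
  have *: "\<omega> i = -1 \<or> \<omega> i = 1" if "1 \<le> i" for i
    using assms(3) that by (auto simp: coin_outcomes_def PiE_iff)
  have C: "?C \<subseteq> {\<omega> \<in> space coin_measure. \<not> Q \<omega>}"
  proof
    fix \<omega>' assume "\<omega>' \<in> ?C"
    then have "\<omega>' \<in> coin_outcomes" and eq: "\<And>i. 1 \<le> i \<Longrightarrow> i \<le> n \<Longrightarrow> \<omega>' i = \<omega> i"
      by (auto simp: prod_emb_def coin_outcomes_def space_uniform_count_measure restrict_PiE_iff Pi_iff)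
    then have "Q \<omega>' = Q \<omega>"
      using known_atD[OF assms(2)] assms(3) truncate_cong[of n \<omega>' \<omega>] by metis
    with \<open>\<not> Q \<omega>\<close> \<open>\<omega>' \<in> coin_outcomes\<close> show "\<omega>' \<in> {\<omega> \<in> space coin_measure. \<not> Q \<omega>}"
      by (simp add: space_coin_measure)
  qed
  have meas: "\<And>i. i \<in> {1..n} \<Longrightarrow> {\<omega> i} \<in> sets (?M i)"
    using * by (auto simp: sets_uniform_count_measure)
  have "emeasure (Pi\<^sub>M {1..} ?M) ?C = (\<Prod>i\<in>{1..n}. emeasure (?M i) {\<omega> i})"
    using meas by (intro emeasure_PiM_emb) auto
  also have "\<dots> = (\<Prod>i\<in>{1..n}. ennreal (1 / 2))"
    using * by (intro prod.cong) (auto simp: emeasure_uniform_count_measure)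
  also have "\<dots> \<noteq> 0" by simp
  finally have "emeasure coin_measure ?C \<noteq> 0" by (simp add: coin_measure_def)
  moreover obtain N where N: "{\<omega> \<in> space coin_measure. \<not> Q \<omega>} \<subseteq> N"
      "emeasure coin_measure N = 0" "N \<in> sets coin_measure"
    using assms(1) by (rule AE_E)
  have "emeasure coin_measure ?C \<le> emeasure coin_measure N"
    using C N by (intro emeasure_mono) auto
  ultimately show False using N(2) by simp
qed

section \<open>Interpolated stock paths and adaptedness of the cost\<close>

text \<open>Each increment of \<open>y\<close> is weighted by a ramp that rises from 0 to 1 while
  \<open>n * t\<close> runs from \<open>j\<close> to \<open>j + 1\<close>. Without the floor
  function, continuity is evident and one sees which increments have started by time
  \<open>t\<close>.\<close>

lemma interpolation_eq_sum:
  assumes "t \<in> {0..1}"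
  shows "interpolation n y t =
    y 0 + (\<Sum>j<n. (y (Suc j) - y j) * max 0 (min 1 (real n * t - real j)))"
proof -
  define m where "m = nat \<lfloor>real n * t\<rfloor>"
  have nt: "0 \<le> real n * t" "real n * t \<le> real n"
    using assms by (auto intro: mult_left_le)
  have m: "of_int \<lfloor>real n * t\<rfloor> = real m" using nt by (simp add: m_def)
  have m_le: "real m \<le> real n * t" "real n * t < real m + 1"
    using m by linarith+
  have "m \<le> n" using m_le nt by linarith
  have tel: "(\<Sum>j<m. y (Suc j) - y j) = y m - y 0" by (rule sum_lessThan_telescope)
  have "(\<Sum>j<m. (y (Suc j) - y j) * max 0 (min 1 (real n * t - real j))) = y m - y 0"
    unfolding tel[symmetric] using m_le by (intro sum.cong) (auto simp: min_def max_def)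
  moreover have "(\<Sum>j=m..<n. (y (Suc j) - y j) * max 0 (min 1 (real n * t - real j))) =
      (y (Suc m) - y m) * (real n * t - real m)"
  \<comment> \<open>Here \<open>m = n\<close> is the right end: the sum is empty and the weight
    \<open>real n * t - real m\<close> of the extra value \<open>y (Suc n)\<close> vanishes.\<close>
  proof (cases "m = n")
    case True
    then show ?thesis using m_le nt by simp
  next
    case False
    have "(\<Sum>j=Suc m..<n. (y (Suc j) - y j) * max 0 (min 1 (real n * t - real j))) = 0"
      using m_le by (intro sum.neutral) (auto simp: min_def max_def)
    with False \<open>m \<le> n\<close> m_le show ?thesis by (simp add: sum.atLeast_Suc_lessThan)
  qed
  moreover have "(\<Sum>j<n. h j) = (\<Sum>j<m. h j) + (\<Sum>j=m..<n. h j)" for h :: "nat \<Rightarrow> real"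
    using \<open>m \<le> n\<close> by (simp add: lessThan_atLeast0 sum.atLeastLessThan_concat)
  ultimately have "y 0 + (\<Sum>j<n. (y (Suc j) - y j) * max 0 (min 1 (real n * t - real j))) =
      y m + (y (Suc m) - y m) * (real n * t - real m)"
    by simp
  also have "\<dots> = (real m + 1 - real n * t) * y m + (real n * t - real m) * y (m + 1)"
    by (simp add: algebra_simps)
  also have "\<dots> = interpolation n y t"
    using assms m unfolding m_def by (simp add: interpolation_def)
  finally show ?thesis ..
qed

lemma interpolation_in_positive_paths:
  assumes "\<And>k. y k > 0"
  shows "interpolation n y \<in> positive_paths"
proof -
  let ?f = "\<lambda>t. y 0 + (\<Sum>j<n. (y (Suc j) - y j) * max 0 (min 1 (real n * t - real j)))"
  have "continuous_on {0..1} ?f" by (intro continuous_intros)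
  then have cont: "continuous_on {0..1} (interpolation n y)"
    by (rule continuous_on_cong[THEN iffD1, rotated 2]) (auto simp: interpolation_eq_sum)
  have "interpolation n y \<in> extensional {0..1}" by (simp add: interpolation_def)
  \<comment> \<open>The path space consists of bounded continuous functions; compactness of the
    interval makes boundedness automatic.\<close>
  moreover have "compactin (top_of_set {0..1::real}) (topspace (top_of_set {0..1}))"
    by (simp add: compactin_subtopology)
  moreover have "interpolation n y t > 0" if "t \<in> {0..1}" for t
  proof -
    define r where "r = real n * t - of_int \<lfloor>real n * t\<rfloor>"
    have r: "0 \<le> r" "r < 1" unfolding r_def by linarith+
    have "interpolation n y t = (1 - r) * y (nat \<lfloor>real n * t\<rfloor>) + r * y (nat \<lfloor>real n * t\<rfloor> + 1)"
      using that by (simp add: interpolation_def r_def)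
    also have "\<dots> > 0"
      using r assms by (intro add_pos_nonneg mult_pos_pos mult_nonneg_nonneg) (auto intro: less_imp_le)
    finally show ?thesis .
  qed
  ultimately show ?thesis
    unfolding positive_paths_def path_metric_def
    using cont by (subst compactin_mspace_cfunspace) (auto simp: continuous_map_iff_continuous)
qed

text \<open>By time \<open>k / n\<close> the ramps with index at least \<open>k\<close> are still
  zero, and the earlier increments involve only values up to index \<open>k\<close>.\<close>

lemma interpolation_cong:
  assumes "n \<ge> 1" "t \<le> real k / real n" "\<And>j. j \<le> k \<Longrightarrow> y j = y' j"
  shows "interpolation n y t = interpolation n y' t"
proof (cases "t \<in> {0..1}")
  case True
  have "real n * t \<le> real k" using assms(1,2) by (simp add: field_simps)
  then have "(y (Suc j) - y j) * max 0 (min 1 (real n * t - real j)) =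
    (y' (Suc j) - y' j) * max 0 (min 1 (real n * t - real j))" for j
    using assms(3)[of j] assms(3)[of "Suc j"] by (cases "j < k") (auto simp: max_def min_def)
  then show ?thesis using assms(3)[of 0] True unfolding interpolation_eq_sum[OF True] by (simp only:)
qed (auto simp: interpolation_def)

lemma stock_path_in_positive_paths: "s0 > 0 \<Longrightarrow> stock_path \<sigma> s0 n \<omega> \<in> positive_paths"
  unfolding stock_path_def by (intro interpolation_in_positive_paths) (simp add: stock_def)

lemma known_at_stock: "known_at k (stock \<sigma> s0 n k)"
  by (rule known_atI) (simp add: stock_def \<xi>_def)

lemma stock_cong: "(\<And>i. 1 \<le> i \<Longrightarrow> i \<le> k \<Longrightarrow> \<omega> i = \<omega>' i) \<Longrightarrow> stock \<sigma> s0 n k \<omega> = stock \<sigma> s0 n k \<omega>'"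
  by (simp add: stock_def \<xi>_def)

lemma known_at_stock_path: "n \<ge> 1 \<Longrightarrow> known_at n (stock_path \<sigma> s0 n)"
proof (intro known_atI ext)
  fix \<omega> \<omega>' :: "nat \<Rightarrow> real" and t :: real
  assume "n \<ge> 1" and eq: "\<And>i. 1 \<le> i \<Longrightarrow> i \<le> n \<Longrightarrow> \<omega> i = \<omega>' i"
  show "stock_path \<sigma> s0 n \<omega> t = stock_path \<sigma> s0 n \<omega>' t"
  proof (cases "t \<le> 1")
    case True
    then show ?thesis
      unfolding stock_path_def using \<open>n \<ge> 1\<close> eq by (intro interpolation_cong[of n t n] stock_cong) auto
  qed (simp add: stock_path_def interpolation_def)
qed

text \<open>Scenarios agreeing up to \<open>k\<close> give paths agreeing on
  \<open>[0, k/n]\<close>, where the adaptedness of \<open>g\<close> applies. The value is the whole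
  function of the trade size, so that any trade known at \<open>k\<close> can be inserted.\<close>

lemma known_at_trading_cost:
  assumes "trading_cost g" "s0 > 0" "n \<ge> 1" "k \<le> n"
  shows "known_at k (\<lambda>\<omega>. g (real k / real n) (stock_path \<sigma> s0 n \<omega>))"
proof (intro known_atI ext)
  fix \<omega> \<omega>' :: "nat \<Rightarrow> real" and \<nu> assume eq: "\<And>i. 1 \<le> i \<Longrightarrow> i \<le> k \<Longrightarrow> \<omega> i = \<omega>' i"
  have "\<forall>s\<in>{0..real k / real n}. stock_path \<sigma> s0 n \<omega> s = stock_path \<sigma> s0 n \<omega>' s"
    unfolding stock_path_def using \<open>n \<ge> 1\<close> eq by (auto intro!: interpolation_cong[of n _ k] stock_cong)
  moreover have "real k / real n \<in> {0..1}" using assms by simp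
  ultimately show "g (real k / real n) (stock_path \<sigma> s0 n \<omega>) \<nu> = g (real k / real n) (stock_path \<sigma> s0 n \<omega>') \<nu>"
    using assms(1) stock_path_in_positive_paths[OF assms(2)] unfolding trading_cost_def by blast
qed

section \<open>Extended expectations and Legendre transforms\<close>

lemma expectation_ereal_mono:
  assumes "\<And>\<omega>. \<omega> \<in> space M \<Longrightarrow> X \<omega> \<le> Y \<omega>"
  shows "expectation_ereal M X \<le> expectation_ereal M Y"
  unfolding expectation_ereal_def using assms
  by (intro ereal_minus_mono)
    (auto simp: less_eq_ennreal.rep_eq[symmetric] intro!: nn_integral_mono e2ennreal_mono)

lemma expectation_ereal_cong_AE:
  assumes "AE \<omega> in M. X \<omega> = Y \<omega>"
  shows "expectation_ereal M X = expectation_ereal M Y"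
proof -
  have "(\<integral>\<^sup>+ \<omega>. e2ennreal (X \<omega>) \<partial>M) = (\<integral>\<^sup>+ \<omega>. e2ennreal (Y \<omega>) \<partial>M)"
    "(\<integral>\<^sup>+ \<omega>. e2ennreal (- X \<omega>) \<partial>M) = (\<integral>\<^sup>+ \<omega>. e2ennreal (- Y \<omega>) \<partial>M)"
    using assms by (auto intro!: nn_integral_cong_AE)
  then show ?thesis by (simp add: expectation_ereal_def)
qed

lemma expectation_ereal_ereal:
  assumes "integrable M f"
  shows "expectation_ereal M (\<lambda>\<omega>. ereal (f \<omega>)) = ereal (\<integral>\<omega>. f \<omega> \<partial>M)"
proof -
  obtain a b where "(\<integral>\<^sup>+ \<omega>. ennreal (f \<omega>) \<partial>M) = ennreal a" "0 \<le> a"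
    "(\<integral>\<^sup>+ \<omega>. ennreal (- f \<omega>) \<partial>M) = ennreal b" "0 \<le> b"
    using assms by (metis real_integrable_def ennreal_cases infinity_ennreal_def)
  then show ?thesis
    using real_lebesgue_integral_def[OF assms] by (simp add: expectation_ereal_def)
qed

text \<open>The finite bound on the integral forces \<open>G\<close> to be finite almost everywhere,
  so it can be replaced by an integrable real function, for which the extended expectation is the
  ordinary one.\<close>

lemma expectation_ereal_diff_ge:
  assumes "integrable M f" and "G \<in> borel_measurable M" and "\<And>\<omega>. 0 \<le> G \<omega>" and "0 \<le> c"
    and "(\<integral>\<^sup>+ \<omega>. e2ennreal (G \<omega>) \<partial>M) \<le> ennreal c"
  shows "ereal ((\<integral>\<omega>. f \<omega> \<partial>M) - c) \<le> expectation_ereal M (\<lambda>\<omega>. ereal (f \<omega>) - G \<omega>)"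
proof -
  note [measurable] = assms(2)
  define r where "r \<omega> = real_of_ereal (G \<omega>)" for \<omega>
  have r_nonneg: "0 \<le> r \<omega>" for \<omega>
    using assms(3) by (simp add: r_def real_of_ereal_pos)
  have [measurable]: "r \<in> borel_measurable M"
    unfolding r_def by measurable
  have "(\<integral>\<^sup>+ \<omega>. e2ennreal (G \<omega>) \<partial>M) \<noteq> \<infinity>"
    using assms(5) by (metis ennreal_less_top infinity_ennreal_def leD)
  then have "AE \<omega> in M. e2ennreal (G \<omega>) \<noteq> \<infinity>"
    by (intro nn_integral_PInf_AE) measurable
  then have AE: "AE \<omega> in M. G \<omega> = ereal (r \<omega>)"
  proof eventually_elim
    case (elim \<omega>)
    then show ?case using assms(3)[of \<omega>] by (cases "G \<omega>") (auto simp: r_def)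
  qed
  have "(\<integral>\<^sup>+ \<omega>. ennreal (r \<omega>) \<partial>M) = (\<integral>\<^sup>+ \<omega>. e2ennreal (G \<omega>) \<partial>M)"
    by (rule nn_integral_cong_AE) (use AE in \<open>auto simp flip: e2ennreal_ereal\<close>)
  with assms(5) have le: "(\<integral>\<^sup>+ \<omega>. ennreal (r \<omega>) \<partial>M) \<le> ennreal c" by simp
  then have int: "integrable M r"
    using r_nonneg by (intro integrableI_nonneg) (auto intro: le_less_trans)
  then have "(\<integral>\<omega>. r \<omega> \<partial>M) \<le> c"
    using le nn_integral_eq_integral[OF int] r_nonneg assms(4) by simp
  moreover have "expectation_ereal M (\<lambda>\<omega>. ereal (f \<omega>) - G \<omega>) =
      expectation_ereal M (\<lambda>\<omega>. ereal (f \<omega> - r \<omega>))"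
    using AE by (intro expectation_ereal_cong_AE) (auto elim!: eventually_mono)
  ultimately show ?thesis
    using expectation_ereal_ereal[of M "\<lambda>\<omega>. f \<omega> - r \<omega>"] int assms(1) by simp
qed

text \<open>The supremum is approached by an increasing sequence of attained values, even if it is
  infinite, and sup-continuity carries this over to \<open>ennreal\<close>.\<close>

lemma ex_incseq_legendre:
  fixes h :: "real \<Rightarrow> real"
  assumes "h 0 = 0"
  shows "\<exists>\<nu>. (\<forall>m. 0 \<le> \<nu> m * y - h (\<nu> m)) \<and> incseq (\<lambda>m. \<nu> m * y - h (\<nu> m)) \<and>
    (SUP m. ennreal (\<nu> m * y - h (\<nu> m))) = e2ennreal (SUP \<nu>. ereal (\<nu> * y - h \<nu>))"
proof -
  let ?v = "\<lambda>\<nu>. \<nu> * y - h \<nu>"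
  obtain a :: "nat \<Rightarrow> ereal" where a: "incseq a" "range a \<subseteq> range (\<lambda>\<nu>. ereal (?v \<nu>))"
    "(SUP \<nu>. ereal (?v \<nu>)) = (SUP m. a m)"
    using Sup_countable_SUP[of "range (\<lambda>\<nu>. ereal (?v \<nu>))"] by auto
  then have "\<forall>m. \<exists>\<mu>. a m = ereal (?v \<mu>)" by blast
  then obtain \<mu> where \<mu>: "\<And>m. a m = ereal (?v (\<mu> m))" by metis
  \<comment> \<open>Not trading has value 0 since \<open>h 0 = 0\<close>, so it replaces every trade
    of negative value; this takes the positive part of the sequence.\<close>
  define \<nu> where "\<nu> m = (if ?v (\<mu> m) < 0 then 0 else \<mu> m)" for m
  have \<nu>: "?v (\<nu> m) = max 0 (?v (\<mu> m))" for m
    using assms by (simp add: \<nu>_def)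
  have "incseq (\<lambda>m. ?v (\<mu> m))"
    using a(1) \<mu> by (simp add: incseq_def)
  then have "incseq (\<lambda>m. ?v (\<nu> m))"
    unfolding \<nu> incseq_def by (meson max.mono order_refl)
  moreover have "(SUP m. ennreal (?v (\<nu> m))) = (SUP m. e2ennreal (a m))"
    by (simp add: \<nu> \<mu> max_def ennreal_neg cong: if_cong) (intro SUP_cong; auto simp: ennreal_neg)
  moreover have "e2ennreal (SUP m. a m) = (SUP m. e2ennreal (a m))"
    using sup_continuousD[OF sup_continuous_e2ennreal[OF sup_continuous_id] a(1)] .
  ultimately show ?thesis
    using \<nu> a(3) by (intro exI[of _ \<nu>]) simp
qed

section \<open>Probability measures on \<open>\<F>\<^sub>n\<close>\<close>

lemma space_prob_measures: "P \<in> prob_measures n \<Longrightarrow> space P = coin_outcomes"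
  using sets_eq_imp_space_eq[of P "coin_filtration n"] by (simp add: prob_measures_def)

lemma known_at_borel_measurable:
  fixes f :: "(nat \<Rightarrow> real) \<Rightarrow> 'a::t1_space"
  assumes "P \<in> prob_measures n" "known_at n f"
  shows "f \<in> borel_measurable P"
proof -
  have "sets P = sets (coin_filtration n)" using assms(1) by (simp add: prob_measures_def)
  then show ?thesis
    using assms(2) by (simp add: borel_measurable_coin_filtration_iff cong: measurable_cong_sets)
qed

text \<open>A function known at \<open>n\<close> takes only finitely many values, hence is
  bounded.\<close>

lemma known_at_integrable:
  fixes f :: "(nat \<Rightarrow> real) \<Rightarrow> real"
  assumes "P \<in> prob_measures n" "known_at n f"
  shows "integrable P f"
proof -
  interpret prob_space P using assms(1) by (simp add: prob_measures_def)
  have "space P = coin_outcomes" using assms(1) by (rule space_prob_measures)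
  moreover have "norm (f \<omega>) \<le> Max ((\<lambda>\<omega>. \<bar>f \<omega>\<bar>) ` truncate n ` coin_outcomes)" if "\<omega> \<in> coin_outcomes" for \<omega>
    using that known_atD[OF assms(2) that]
    by (intro Max_ge finite_imageI finite_truncate_image) (force simp: image_image)
  ultimately show ?thesis
    using known_at_borel_measurable[OF assms] by (intro integrable_const_bound AE_I2) auto
qed

text \<open>This turns the weights supplied by the minimax theorem into a measure. The point measure
  lives on the power set of the truncated outcomes; its image under the identity has the required
  space and \<sigma>-algebra.\<close>

lemma ex_prob_measure:
  fixes p :: "(nat \<Rightarrow> real) \<Rightarrow> real"
  assumes "\<And>a. a \<in> truncate n ` coin_outcomes \<Longrightarrow> 0 \<le> p a" "sum p (truncate n ` coin_outcomes) = 1"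
  shows "\<exists>P\<in>prob_measures n. \<forall>f :: _ \<Rightarrow> real. known_at n f \<longrightarrow>
    (\<integral>\<omega>. f \<omega> \<partial>P) = (\<Sum>a\<in>truncate n ` coin_outcomes. p a * f a)"
proof
  let ?I = "truncate n ` coin_outcomes"
  let ?D = "point_measure ?I p"
  let ?P = "distr ?D (coin_filtration n) (\<lambda>\<omega>. \<omega>)"
  have meas: "(\<lambda>\<omega>. \<omega>) \<in> measurable ?D (coin_filtration n)"
    by (auto simp: measurable_def space_point_measure sets_point_measure)
  have "prob_space ?D"
  proof
    have "emeasure ?D ?I = (\<Sum>a\<in>?I. ennreal (p a))"
      using finite_truncate_image by (intro emeasure_point_measure_finite) auto
    then show "emeasure ?D (space ?D) = 1"
      using assms by (simp add: space_point_measure sum_ennreal)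
  qed
  then show "?P \<in> prob_measures n"
    using prob_space.prob_space_distr[OF _ meas] by (simp add: prob_measures_def)
  show "\<forall>f :: _ \<Rightarrow> real. known_at n f \<longrightarrow> (\<integral>\<omega>. f \<omega> \<partial>?P) = (\<Sum>a\<in>?I. p a * f a)"
    using assms(1) finite_truncate_image
    by (auto simp: integral_distr[OF meas] borel_measurable_coin_filtration_iff
        lebesgue_integral_point_measure_finite simp del: image_iff)
qed

text \<open>\<open>real_cond_exp\<close> is a fixed version, measurable for
  \<open>\<F>\<^sub>k\<close> itself, and is therefore constant on every atom, including those of
  \<open>P\<close>-measure zero.\<close>

lemma real_cond_exp_tower:
  fixes f :: "(nat \<Rightarrow> real) \<Rightarrow> real"
  assumes P: "P \<in> prob_measures n" and "k \<le> n" and "known_at k h" and "known_at n f"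
  shows "known_at k (real_cond_exp P (coin_filtration k) f)"
    and "(\<integral>\<omega>. h \<omega> * real_cond_exp P (coin_filtration k) f \<omega> \<partial>P) = (\<integral>\<omega>. h \<omega> * f \<omega> \<partial>P)"
proof -
  interpret prob_space P using P by (simp add: prob_measures_def)
  have sets: "sets P = sets (coin_filtration n)" using P by (simp add: prob_measures_def)
  have "space P = coin_outcomes" using P by (rule space_prob_measures)
  then interpret finite_measure_subalgebra P "coin_filtration k"
    using sets \<open>k \<le> n\<close> by unfold_locales (rule subalgebra_coin_filtration)
  show "known_at k (real_cond_exp P (coin_filtration k) f)"
    by (simp flip: borel_measurable_coin_filtration_iff)
  have "known_at n (\<lambda>\<omega>. h \<omega> * f \<omega>)"
    using assms(4) known_at_mono[OF assms(3,2)] by (simp add: known_at_def)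
  then show "(\<integral>\<omega>. h \<omega> * real_cond_exp P (coin_filtration k) f \<omega> \<partial>P) = (\<integral>\<omega>. h \<omega> * f \<omega> \<partial>P)"
    using assms known_at_integrable[OF P] known_at_borel_measurable[OF P]
    by (intro real_cond_exp_intg) (auto simp: borel_measurable_coin_filtration_iff)
qed

section \<open>Hedging in terms of trades\<close>

locale market =
  fixes \<sigma> s0 :: real and n :: nat and g :: "real \<Rightarrow> (real \<Rightarrow> real) \<Rightarrow> real \<Rightarrow> real"
  assumes n_pos: "n \<ge> 1" and s0_pos: "s0 > 0" and trading_cost: "trading_cost g"
begin

abbreviation cost :: "nat \<Rightarrow> (nat \<Rightarrow> real) \<Rightarrow> real \<Rightarrow> real" where
  "cost k \<omega> \<equiv> g (real k / real n) (stock_path \<sigma> s0 n \<omega>)"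

text \<open>\<open>\<delta> k\<close> stands for the trade
  \<open>\<gamma> (k + 1) - \<gamma> k\<close>; predictability of \<gamma> becomes adaptedness
  without a shift of index.\<close>

definition adapted :: "(nat \<Rightarrow> (nat \<Rightarrow> real) \<Rightarrow> real) \<Rightarrow> bool" where
  "adapted \<delta> \<longleftrightarrow> (\<forall>k<n. known_at k (\<delta> k))"

definition gain :: "(nat \<Rightarrow> (nat \<Rightarrow> real) \<Rightarrow> real) \<Rightarrow> (nat \<Rightarrow> real) \<Rightarrow> real" where
  "gain \<delta> \<omega> = (\<Sum>k<n. \<delta> k \<omega> * (stock \<sigma> s0 n n \<omega> - stock \<sigma> s0 n k \<omega>) - cost k \<omega> (\<delta> k \<omega>))"

text \<open>The deviation of the stock from the \<open>P\<close>-martingale with the same terminal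
  value.\<close>

definition drift :: "(nat \<Rightarrow> real) measure \<Rightarrow> nat \<Rightarrow> (nat \<Rightarrow> real) \<Rightarrow> real" where
  "drift P k \<omega> = real_cond_exp P (coin_filtration k) (stock \<sigma> s0 n n) \<omega> - stock \<sigma> s0 n k \<omega>"

lemma cost_props:
  assumes "k < n"
  shows "cost k \<omega> 0 = 0" and "convex_on UNIV (cost k \<omega>)"
  using trading_cost stock_path_in_positive_paths[OF s0_pos] assms by (auto simp: trading_cost_def)

lemma known_at_cost: "k \<le> n \<Longrightarrow> known_at k (cost k)"
  using known_at_trading_cost[OF trading_cost s0_pos n_pos] .

lemma known_at_drift:
  assumes "P \<in> prob_measures n" "k \<le> n"
  shows "known_at k (drift P k)"
  using real_cond_exp_tower(1)[OF assms, of "\<lambda>_. 0"] known_at_stock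
  by (simp add: known_at_def drift_def)

lemma known_at_gain: "adapted \<delta> \<Longrightarrow> known_at n (gain \<delta>)"
  unfolding known_at_def gain_def
proof (intro ballI sum.cong refl)
  fix \<omega> k assume "adapted \<delta>" "\<omega> \<in> coin_outcomes" "k \<in> {..<n}"
  then have "known_at n (\<delta> k)" "known_at n (cost k)" "known_at n (stock \<sigma> s0 n k)"
    using known_at_mono[OF known_at_cost, of k n]
    by (auto simp: adapted_def intro: known_at_mono[of k] known_at_stock)
  then show "\<delta> k (truncate n \<omega>) * (stock \<sigma> s0 n n (truncate n \<omega>) - stock \<sigma> s0 n k (truncate n \<omega>))
      - cost k (truncate n \<omega>) (\<delta> k (truncate n \<omega>)) =
      \<delta> k \<omega> * (stock \<sigma> s0 n n \<omega> - stock \<sigma> s0 n k \<omega>) - cost k \<omega> (\<delta> k \<omega>)"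
    using known_at_stock[of n \<sigma> s0 n] \<open>\<omega> \<in> coin_outcomes\<close> by (simp add: known_at_def)
qed

text \<open>Summation by parts, as an induction on the horizon \<open>m\<close>: one more step adds
  \<open>S (m + 1) - S m\<close> times the sum of all trades so far, which is the current position
  because the initial position is zero.\<close>

lemma portfolio_value_eq:
  assumes "\<gamma> 0 \<omega> = 0"
  shows "portfolio_value \<sigma> s0 n g (x, \<gamma>) n \<omega> = x + gain (\<lambda>k \<omega>. \<gamma> (Suc k) \<omega> - \<gamma> k \<omega>) \<omega>"
proof -
  let ?S = "\<lambda>k. stock \<sigma> s0 n k \<omega>" and ?d = "\<lambda>k. \<gamma> (Suc k) \<omega> - \<gamma> k \<omega>"
  have "portfolio_value \<sigma> s0 n g (x, \<gamma>) m \<omega> = x + (\<Sum>k<m. ?d k * (?S m - ?S k) - cost k \<omega> (?d k))" for m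
  proof (induction m)
    case (Suc m)
    have "\<gamma> (Suc m) \<omega> = (\<Sum>k<Suc m. ?d k)"
      using sum_lessThan_telescope[of "\<lambda>k. \<gamma> k \<omega>" "Suc m"] assms by simp
    \<comment> \<open>The trade \<open>k = m\<close> contributes zero to the first sum on the right,
      which thus matches the induction hypothesis.\<close>
    moreover have "(\<Sum>k<Suc m. ?d k * (?S (Suc m) - ?S k)) =
        (\<Sum>k<Suc m. ?d k * (?S m - ?S k)) + (\<Sum>k<Suc m. ?d k) * (?S (Suc m) - ?S m)"
      unfolding sum_distrib_right sum.distrib[symmetric] by (intro sum.cong) (auto simp: algebra_simps)
    ultimately show ?case
      using Suc.IH by (simp add: sum_subtractf)
  qed simp
  then show ?thesis by (simp add: gain_def)
qed

text \<open>Differences and partial sums translate between positions and trades. The inequality is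
  known at \<open>n\<close>, so holding almost surely means holding in every scenario.\<close>

lemma super_replication_cost_eq:
  assumes X: "known_at n X"
  shows "super_replication_cost \<sigma> s0 n g X =
    Inf {ereal x | x. \<exists>\<delta>. adapted \<delta> \<and> (\<forall>\<omega>\<in>coin_outcomes. X \<omega> \<le> x + gain \<delta> \<omega>)}"
proof -
  have "(\<exists>\<pi>\<in>portfolios n x. AE \<omega> in coin_measure. portfolio_value \<sigma> s0 n g \<pi> n \<omega> \<ge> X \<omega>) \<longleftrightarrow>
      (\<exists>\<delta>. adapted \<delta> \<and> (\<forall>\<omega>\<in>coin_outcomes. X \<omega> \<le> x + gain \<delta> \<omega>))" for x
  proof
    assume "\<exists>\<pi>\<in>portfolios n x. AE \<omega> in coin_measure. portfolio_value \<sigma> s0 n g \<pi> n \<omega> \<ge> X \<omega>"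
    then obtain \<gamma> where \<gamma>: "\<forall>\<omega>\<in>coin_outcomes. \<gamma> 0 \<omega> = 0"
      "\<forall>k\<in>{1..n}. \<gamma> k \<in> borel_measurable (coin_filtration (k - 1))"
      and AE: "AE \<omega> in coin_measure. portfolio_value \<sigma> s0 n g (x, \<gamma>) n \<omega> \<ge> X \<omega>"
      by (auto simp: portfolios_def)
    let ?\<delta> = "\<lambda>k \<omega>. \<gamma> (Suc k) \<omega> - \<gamma> k \<omega>"
    have "known_at k (\<gamma> (Suc k))" if "k < n" for k
      using \<gamma>(2)[rule_format, of "Suc k"] that by (simp add: borel_measurable_coin_filtration_iff)
    \<comment> \<open>The position \<open>\<gamma> k\<close> is already known at
      \<open>k - 1\<close>; for \<open>k = 0\<close> it is constantly zero.\<close>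
    moreover have "known_at k (\<gamma> k)" if "k < n" for k
    proof (cases k)
      case 0
      then show ?thesis using \<gamma>(1) by (simp add: known_at_def)
    next
      case (Suc j)
      then show ?thesis
        using \<gamma>(2)[rule_format, of k] that known_at_mono[of j _ k]
        by (simp add: borel_measurable_coin_filtration_iff)
    qed
    ultimately have ad: "adapted ?\<delta>"
      by (simp add: adapted_def known_at_def)
    have "AE \<omega> in coin_measure. X \<omega> \<le> x + gain ?\<delta> \<omega>"
      using AE by (rule AE_mp) (auto intro!: AE_I2 simp: space_coin_measure portfolio_value_eq \<gamma>(1))
    moreover have "known_at n (\<lambda>\<omega>. X \<omega> \<le> x + gain ?\<delta> \<omega>)"
      using X known_at_gain[OF ad] by (simp add: known_at_def)
    ultimately show "\<exists>\<delta>. adapted \<delta> \<and> (\<forall>\<omega>\<in>coin_outcomes. X \<omega> \<le> x + gain \<delta> \<omega>)"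
      using ad AE_coin_measure_known_at by blast
  next
    assume "\<exists>\<delta>. adapted \<delta> \<and> (\<forall>\<omega>\<in>coin_outcomes. X \<omega> \<le> x + gain \<delta> \<omega>)"
    then obtain \<delta> where \<delta>: "adapted \<delta>" "\<forall>\<omega>\<in>coin_outcomes. X \<omega> \<le> x + gain \<delta> \<omega>" by blast
    define \<gamma> where "\<gamma> k \<omega> = (\<Sum>j<k. \<delta> j \<omega>)" for k \<omega>
    have "known_at (k - 1) (\<gamma> k)" if "k \<in> {1..n}" for k
      unfolding known_at_def \<gamma>_def
    proof (intro ballI sum.cong refl)
      fix \<omega> j assume "\<omega> \<in> coin_outcomes" "j \<in> {..<k}"
      then show "\<delta> j (truncate (k - 1) \<omega>) = \<delta> j \<omega>"
        using \<delta>(1) that known_at_mono[of j "\<delta> j" "k - 1"] by (auto simp: adapted_def known_at_def)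
    qed
    then have "(x, \<gamma>) \<in> portfolios n x"
      by (auto simp: portfolios_def borel_measurable_coin_filtration_iff \<gamma>_def)
    moreover have "portfolio_value \<sigma> s0 n g (x, \<gamma>) n \<omega> = x + gain \<delta> \<omega>" for \<omega>
      by (subst portfolio_value_eq) (simp_all add: \<gamma>_def)
    ultimately show "\<exists>\<pi>\<in>portfolios n x. AE \<omega> in coin_measure. portfolio_value \<sigma> s0 n g \<pi> n \<omega> \<ge> X \<omega>"
      using \<delta>(2) by (intro bexI[of _ "(x, \<gamma>)"]) (auto intro!: AE_I2 simp: space_coin_measure)
  qed
  then show ?thesis by (simp add: super_replication_cost_def)
qed

section \<open>Weak duality\<close>

text \<open>Since \<open>\<delta> k\<close> is known at \<open>k\<close>, the tower property
  replaces \<open>S(n)\<close> by its conditional expectation in the \<open>k\<close>-th summand.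
  The remaining terms, collected in \<open>?c\<close>, are common to both integrands.\<close>

lemma integral_gain:
  assumes P: "P \<in> prob_measures n" and "adapted \<delta>"
  shows "integrable P (\<lambda>\<omega>. \<Sum>k<n. \<delta> k \<omega> * drift P k \<omega> - cost k \<omega> (\<delta> k \<omega>))"
    and "(\<integral>\<omega>. gain \<delta> \<omega> \<partial>P) = (\<integral>\<omega>. (\<Sum>k<n. \<delta> k \<omega> * drift P k \<omega> - cost k \<omega> (\<delta> k \<omega>)) \<partial>P)"
proof -
  have "integrable P (\<lambda>\<omega>. \<delta> k \<omega> * drift P k \<omega> - cost k \<omega> (\<delta> k \<omega>)) \<and>
      integrable P (\<lambda>\<omega>. \<delta> k \<omega> * (stock \<sigma> s0 n n \<omega> - stock \<sigma> s0 n k \<omega>) - cost k \<omega> (\<delta> k \<omega>)) \<and>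
      (\<integral>\<omega>. \<delta> k \<omega> * (stock \<sigma> s0 n n \<omega> - stock \<sigma> s0 n k \<omega>) - cost k \<omega> (\<delta> k \<omega>) \<partial>P) =
      (\<integral>\<omega>. \<delta> k \<omega> * drift P k \<omega> - cost k \<omega> (\<delta> k \<omega>) \<partial>P)" if "k < n" for k
  proof -
    let ?M = "real_cond_exp P (coin_filtration k) (stock \<sigma> s0 n n)"
    let ?c = "\<lambda>\<omega>. \<delta> k \<omega> * stock \<sigma> s0 n k \<omega> + cost k \<omega> (\<delta> k \<omega>)"
    have \<delta>: "known_at k (\<delta> k)" using assms(2) that by (simp add: adapted_def)
    note tower = real_cond_exp_tower[OF P less_imp_le[OF that] \<delta> known_at_stock]
    have "known_at k ?c"
      using \<delta> known_at_stock[of k \<sigma> s0 n] known_at_cost[of k] that by (simp add: known_at_def)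
    moreover have "known_at k (\<lambda>\<omega>. \<delta> k \<omega> * ?M \<omega>)"
      using \<delta> tower(1) by (simp add: known_at_def)
    moreover have "known_at n (\<lambda>\<omega>. \<delta> k \<omega> * stock \<sigma> s0 n n \<omega>)"
      using known_at_mono[OF \<delta>, of n] known_at_stock[of n \<sigma> s0 n] that by (simp add: known_at_def)
    ultimately have int: "integrable P ?c" "integrable P (\<lambda>\<omega>. \<delta> k \<omega> * ?M \<omega>)"
      "integrable P (\<lambda>\<omega>. \<delta> k \<omega> * stock \<sigma> s0 n n \<omega>)"
      using that by (auto intro!: known_at_integrable[OF P] intro: known_at_mono[OF _ less_imp_le])
    have eq: "(\<lambda>\<omega>. \<delta> k \<omega> * drift P k \<omega> - cost k \<omega> (\<delta> k \<omega>)) = (\<lambda>\<omega>. \<delta> k \<omega> * ?M \<omega> - ?c \<omega>)"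
      "(\<lambda>\<omega>. \<delta> k \<omega> * (stock \<sigma> s0 n n \<omega> - stock \<sigma> s0 n k \<omega>) - cost k \<omega> (\<delta> k \<omega>)) =
        (\<lambda>\<omega>. \<delta> k \<omega> * stock \<sigma> s0 n n \<omega> - ?c \<omega>)"
      by (auto simp: drift_def algebra_simps)
    show ?thesis
      unfolding eq using int tower(2) by (simp only: Bochner_Integration.integral_diff) simp
  qed
  then show "integrable P (\<lambda>\<omega>. \<Sum>k<n. \<delta> k \<omega> * drift P k \<omega> - cost k \<omega> (\<delta> k \<omega>))"
    "(\<integral>\<omega>. gain \<delta> \<omega> \<partial>P) = (\<integral>\<omega>. (\<Sum>k<n. \<delta> k \<omega> * drift P k \<omega> - cost k \<omega> (\<delta> k \<omega>)) \<partial>P)"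
    unfolding gain_def by (auto simp: Bochner_Integration.integral_sum intro!: sum.cong)
qed

text \<open>Each trade of the hedge is a candidate in the supremum defining the Legendre transform.
  Passing to these candidates first leaves an integrable real function, so infinite penalties do no
  harm.\<close>

lemma weak_duality:
  assumes P: "P \<in> prob_measures n" and X: "known_at n X" and \<delta>: "adapted \<delta>"
    and hedge: "\<forall>\<omega>\<in>coin_outcomes. X \<omega> \<le> x + gain \<delta> \<omega>"
  shows "expectation_ereal P (\<lambda>\<omega>. ereal (X \<omega>)
      - (\<Sum>k<n. legendre g (real k / real n) (stock_path \<sigma> s0 n \<omega>) (drift P k \<omega>))) \<le> ereal x"
    (is "expectation_ereal P (\<lambda>\<omega>. _ - ?G \<omega>) \<le> _")
proof -
  interpret prob_space P using P by (simp add: prob_measures_def)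
  let ?u = "\<lambda>\<omega>. \<Sum>k<n. \<delta> k \<omega> * drift P k \<omega> - cost k \<omega> (\<delta> k \<omega>)"
  have "space P = coin_outcomes" using P by (rule space_prob_measures)
  have "expectation_ereal P (\<lambda>\<omega>. ereal (X \<omega>) - ?G \<omega>) \<le> expectation_ereal P (\<lambda>\<omega>. ereal (X \<omega> - ?u \<omega>))"
  proof (rule expectation_ereal_mono)
    fix \<omega>
    have "(\<Sum>k<n. ereal (\<delta> k \<omega> * drift P k \<omega> - cost k \<omega> (\<delta> k \<omega>))) \<le> ?G \<omega>"
      unfolding legendre_def by (intro sum_mono SUP_upper) simp
    then have "ereal (X \<omega>) - ?G \<omega> \<le> ereal (X \<omega>) - ereal (?u \<omega>)"
      by (intro ereal_minus_mono) simp_all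
    then show "ereal (X \<omega>) - ?G \<omega> \<le> ereal (X \<omega> - ?u \<omega>)" by simp
  qed
  also have "\<dots> = ereal ((\<integral>\<omega>. X \<omega> \<partial>P) - (\<integral>\<omega>. gain \<delta> \<omega> \<partial>P))"
    using integral_gain[OF P \<delta>] known_at_integrable[OF P X] by (simp add: expectation_ereal_ereal)
  also have "(\<integral>\<omega>. X \<omega> \<partial>P) \<le> (\<integral>\<omega>. x + gain \<delta> \<omega> \<partial>P)"
    using known_at_integrable[OF P X] known_at_integrable[OF P known_at_gain[OF \<delta>]] hedge
      \<open>space P = coin_outcomes\<close> by (intro integral_mono) auto
  then have "ereal ((\<integral>\<omega>. X \<omega> \<partial>P) - (\<integral>\<omega>. gain \<delta> \<omega> \<partial>P)) \<le> ereal x"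
    using known_at_integrable[OF P known_at_gain[OF \<delta>]] by (simp add: prob_space)
  finally show ?thesis .
qed

section \<open>Strong duality by minimax and monotone convergence\<close>

lemma gain_concave:
  assumes "0 \<le> t" "t \<le> 1"
  shows "(1 - t) * gain \<delta> \<omega> + t * gain \<delta>' \<omega> \<le> gain (\<lambda>k \<omega>. (1 - t) * \<delta> k \<omega> + t * \<delta>' k \<omega>) \<omega>"
  unfolding gain_def sum_distrib_left sum.distrib[symmetric]
proof (rule sum_mono)
  fix k assume "k \<in> {..<n}"
  then have "cost k \<omega> ((1 - t) * \<delta> k \<omega> + t * \<delta>' k \<omega>) \<le> (1 - t) * cost k \<omega> (\<delta> k \<omega>) + t * cost k \<omega> (\<delta>' k \<omega>)"
    using convex_onD[OF cost_props(2)[of k \<omega>] assms, of "\<delta> k \<omega>" "\<delta>' k \<omega>"] by simp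
  then show "(1 - t) * (\<delta> k \<omega> * (stock \<sigma> s0 n n \<omega> - stock \<sigma> s0 n k \<omega>) - cost k \<omega> (\<delta> k \<omega>))
      + t * (\<delta>' k \<omega> * (stock \<sigma> s0 n n \<omega> - stock \<sigma> s0 n k \<omega>) - cost k \<omega> (\<delta>' k \<omega>))
      \<le> ((1 - t) * \<delta> k \<omega> + t * \<delta>' k \<omega>) * (stock \<sigma> s0 n n \<omega> - stock \<sigma> s0 n k \<omega>)
        - cost k \<omega> ((1 - t) * \<delta> k \<omega> + t * \<delta>' k \<omega>)"
    by (simp add: algebra_simps)
qed

text \<open>Every strategy leaves a nonnegative shortfall at some atom. The minimax theorem, with
  atoms as indices and strategies as points, gives one set of weights that makes the mean shortfall
  nonnegative for all strategies at once.\<close>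

lemma ex_minimax_measure:
  assumes X: "known_at n X"
    and no_hedge: "\<And>\<delta>. adapted \<delta> \<Longrightarrow> \<exists>\<omega>\<in>coin_outcomes. v + gain \<delta> \<omega> \<le> X \<omega>"
  shows "\<exists>P\<in>prob_measures n. \<forall>\<delta>. adapted \<delta> \<longrightarrow> (\<integral>\<omega>. gain \<delta> \<omega> \<partial>P) \<le> (\<integral>\<omega>. X \<omega> \<partial>P) - v"
proof -
  let ?I = "truncate n ` coin_outcomes"
  let ?f = "\<lambda>a \<delta>. X a - v - gain \<delta> a"
  have "\<exists>p. (\<forall>a\<in>?I. 0 \<le> p a) \<and> sum p ?I = 1 \<and> (\<forall>\<delta>\<in>Collect adapted. 0 \<le> (\<Sum>a\<in>?I. p a * ?f a \<delta>))"
  proof (rule convexlike_minimax)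
    show "finite ?I" by (rule finite_truncate_image)
    have "(\<lambda>i\<in>{1..}. 1) \<in> coin_outcomes" by (auto simp: coin_outcomes_def)
    then show "?I \<noteq> {}" by blast
  next
    fix \<delta> \<delta>' and t :: real
    assume *: "\<delta> \<in> Collect adapted" "\<delta>' \<in> Collect adapted" "0 \<le> t" "t \<le> 1"
    let ?z = "\<lambda>k \<omega>. (1 - t) * \<delta> k \<omega> + t * \<delta>' k \<omega>"
    have "adapted ?z" using * by (simp add: adapted_def known_at_def)
    moreover have "?f a ?z \<le> (1 - t) * ?f a \<delta> + t * ?f a \<delta>'" for a
      using gain_concave[OF *(3,4), of \<delta> a \<delta>'] by (simp add: algebra_simps)
    ultimately show "\<exists>z\<in>Collect adapted. \<forall>a\<in>?I. ?f a z \<le> (1 - t) * ?f a \<delta> + t * ?f a \<delta>'"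
      by blast
  next
    fix \<delta> assume "\<delta> \<in> Collect adapted"
    then obtain \<omega> where "\<omega> \<in> coin_outcomes" "v + gain \<delta> \<omega> \<le> X \<omega>" "known_at n (gain \<delta>)"
      using no_hedge known_at_gain by blast
    then show "\<exists>a\<in>?I. 0 \<le> ?f a \<delta>"
      using X by (intro bexI[of _ "truncate n \<omega>"]) (auto simp: known_at_def)
  qed
  then obtain p where p: "\<forall>a\<in>?I. 0 \<le> p a" "sum p ?I = 1"
    "\<forall>\<delta>. adapted \<delta> \<longrightarrow> 0 \<le> (\<Sum>a\<in>?I. p a * ?f a \<delta>)" by blast
  then obtain P where P: "P \<in> prob_measures n"
    "\<And>f :: _ \<Rightarrow> real. known_at n f \<Longrightarrow> (\<integral>\<omega>. f \<omega> \<partial>P) = (\<Sum>a\<in>?I. p a * f a)"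
    using ex_prob_measure[of n p] by blast
  have "(\<integral>\<omega>. gain \<delta> \<omega> \<partial>P) \<le> (\<integral>\<omega>. X \<omega> \<partial>P) - v" if "adapted \<delta>" for \<delta>
  proof -
    have "(\<Sum>a\<in>?I. p a * ?f a \<delta>) = (\<Sum>a\<in>?I. p a * X a) - v * sum p ?I - (\<Sum>a\<in>?I. p a * gain \<delta> a)"
      by (simp add: sum_distrib_left sum_subtractf[symmetric] algebra_simps)
    then show ?thesis
      using p(2,3) that P(2)[OF X] P(2)[OF known_at_gain[OF that]] by auto
  qed
  with P(1) show ?thesis by blast
qed

text \<open>The Legendre transforms may be infinite, so the near-optimal trades are chosen as sequences with
  increasing nonnegative values, and monotone convergence replaces a measurable selection.\<close>

lemma expectation_ge_of_gain_le:
  assumes P: "P \<in> prob_measures n" and X: "known_at n X"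
    and gain_le: "\<And>\<delta>. adapted \<delta> \<Longrightarrow> (\<integral>\<omega>. gain \<delta> \<omega> \<partial>P) \<le> (\<integral>\<omega>. X \<omega> \<partial>P) - v"
  shows "ereal v \<le> expectation_ereal P (\<lambda>\<omega>. ereal (X \<omega>)
      - (\<Sum>k<n. legendre g (real k / real n) (stock_path \<sigma> s0 n \<omega>) (drift P k \<omega>)))"
    (is "_ \<le> expectation_ereal P (\<lambda>\<omega>. _ - ?G \<omega>)")
proof -
  let ?good = "\<lambda>y h \<nu>. (\<forall>m::nat. 0 \<le> \<nu> m * y - h (\<nu> m)) \<and> incseq (\<lambda>m. \<nu> m * y - h (\<nu> m)) \<and>
    (SUP m. ennreal (\<nu> m * y - h (\<nu> m))) = e2ennreal (SUP \<nu>. ereal (\<nu> * y - h \<nu> :: real))"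
  \<comment> \<open>The choice depends on the outcome only through the drift and the cost function,
    both known at \<open>k\<close>, so the resulting trades are adapted.\<close>
  define \<nu> where "\<nu> y h = (SOME \<nu>. ?good y h \<nu>)" for y and h :: "real \<Rightarrow> real"
  have good: "?good y h (\<nu> y h)" if "h 0 = 0" for y h
    unfolding \<nu>_def using ex_incseq_legendre[of h y, OF that] by (rule someI_ex)
  define \<delta> where "\<delta> m k \<omega> = \<nu> (drift P k \<omega>) (cost k \<omega>) m" for m k \<omega>
  have \<delta>: "adapted (\<delta> m)" for m
    using known_at_drift[OF P] known_at_cost by (simp add: adapted_def \<delta>_def known_at_def)
  define u where "u m k \<omega> = \<delta> m k \<omega> * drift P k \<omega> - cost k \<omega> (\<delta> m k \<omega>)" for m k \<omega>
  let ?L = "\<lambda>k \<omega>. legendre g (real k / real n) (stock_path \<sigma> s0 n \<omega>) (drift P k \<omega>)"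
  have u: "0 \<le> u m k \<omega>" "incseq (\<lambda>m. u m k \<omega>)" "(SUP m. ennreal (u m k \<omega>)) = e2ennreal (?L k \<omega>)"
    if "k < n" for m k \<omega>
    using good[of "cost k \<omega>" "drift P k \<omega>", OF cost_props(1)[OF that, of \<omega>]] by (auto simp: u_def \<delta>_def legendre_def)
  have L: "0 \<le> ?L k \<omega>" if "k < n" for k \<omega>
    unfolding legendre_def using cost_props(1)[OF that, of \<omega>] by (intro SUP_upper2[of 0]) auto
  have G: "0 \<le> ?G \<omega>" for \<omega> using L by (intro sum_nonneg) auto
  have "known_at n ?G"
    unfolding known_at_def
  proof (intro ballI sum.cong refl)
    fix \<omega> k assume "\<omega> \<in> coin_outcomes" "k \<in> {..<n}"
    then show "?L k (truncate n \<omega>) = ?L k \<omega>"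
      using known_at_mono[OF known_at_drift[OF P], of k n] known_at_stock_path[OF n_pos, of \<sigma> s0]
      by (simp add: known_at_def)
  qed
  define w where "w m \<omega> = (\<Sum>k<n. u m k \<omega>)" for m \<omega>
  have w_nonneg: "0 \<le> w m \<omega>" for m \<omega> unfolding w_def using u(1) by (intro sum_nonneg) auto
  have w: "integrable P (w m)" "(\<integral>\<omega>. w m \<omega> \<partial>P) \<le> (\<integral>\<omega>. X \<omega> \<partial>P) - v" for m
    using integral_gain[OF P \<delta>[of m]] gain_le[OF \<delta>[of m]] by (auto simp: w_def[abs_def] u_def)
  \<comment> \<open>Nonnegativity of the bound is needed to express it in
    \<open>ennreal\<close>.\<close>
  have "0 \<le> (\<integral>\<omega>. w 0 \<omega> \<partial>P)" using w_nonneg by simp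
  with w(2)[of 0] have c: "0 \<le> (\<integral>\<omega>. X \<omega> \<partial>P) - v" by simp
  have SUP_w: "e2ennreal (?G \<omega>) = (SUP m. ennreal (w m \<omega>))" for \<omega>
  proof -
    have "?G \<omega> = enn2ereal (\<Sum>k<n. e2ennreal (?L k \<omega>))"
      using L by (simp flip: sum_enn2ereal add: enn2ereal_e2ennreal)
    then have "e2ennreal (?G \<omega>) = (\<Sum>k<n. SUP m. ennreal (u m k \<omega>))" using u(3) by simp
    \<comment> \<open>Finite sums commute with the supremum because every summand increases in
      \<open>m\<close>.\<close>
    also have "\<dots> = (SUP m. \<Sum>k<n. ennreal (u m k \<omega>))"
      using u(2) by (intro ennreal_SUP_sum[symmetric]) (auto simp: incseq_def intro!: ennreal_leI)
    also have "\<dots> = (SUP m. ennreal (w m \<omega>))"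
      unfolding w_def using u(1) by (intro SUP_cong refl sum_ennreal) auto
    finally show ?thesis .
  qed
  have "(\<integral>\<^sup>+ \<omega>. e2ennreal (?G \<omega>) \<partial>P) = (SUP m. \<integral>\<^sup>+ \<omega>. ennreal (w m \<omega>) \<partial>P)"
    unfolding SUP_w
  proof (rule nn_integral_monotone_convergence_SUP)
    show "incseq (\<lambda>m \<omega>. ennreal (w m \<omega>))"
      using u(2) by (auto simp: incseq_def le_fun_def w_def intro!: ennreal_leI sum_mono)
    show "(\<lambda>\<omega>. ennreal (w m \<omega>)) \<in> borel_measurable P" for m
      using w(1)[of m] by measurable
  qed
  also have "\<dots> \<le> ennreal ((\<integral>\<omega>. X \<omega> \<partial>P) - v)"
    using w w_nonneg by (intro SUP_least) (auto simp: nn_integral_eq_integral intro!: ennreal_leI)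
  \<comment> \<open>The bound on the penalties is \<open>E[X] - v\<close>, so what remains of
    \<open>E[X]\<close> is \<open>v\<close>.\<close>
  finally have "ereal ((\<integral>\<omega>. X \<omega> \<partial>P) - ((\<integral>\<omega>. X \<omega> \<partial>P) - v)) \<le> expectation_ereal P (\<lambda>\<omega>. ereal (X \<omega>) - ?G \<omega>)"
    using G c known_at_borel_measurable[OF P \<open>known_at n ?G\<close>] known_at_integrable[OF P X]
    by (intro expectation_ereal_diff_ge) auto
  then show ?thesis by simp
qed

lemma duality:
  assumes X: "known_at n X"
  shows "super_replication_cost \<sigma> s0 n g X =
    (SUP P\<in>prob_measures n. expectation_ereal P (\<lambda>\<omega>. ereal (X \<omega>)
       - (\<Sum>k<n. legendre g (real k / real n) (stock_path \<sigma> s0 n \<omega>) (drift P k \<omega>))))"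
    (is "_ = (SUP P\<in>_. ?E P)")
proof (rule antisym)
  show "(SUP P\<in>prob_measures n. ?E P) \<le> super_replication_cost \<sigma> s0 n g X"
    unfolding super_replication_cost_eq[OF X]
    using weak_duality[OF _ X] by (intro SUP_least Inf_greatest) blast
  show "super_replication_cost \<sigma> s0 n g X \<le> (SUP P\<in>prob_measures n. ?E P)"
  \<comment> \<open>Only real \<open>v\<close> strictly below the cost matter, whether or not the
    cost is finite. No strategy hedges from such a \<open>v\<close>, which is what the minimax
    argument requires.\<close>
  proof (rule dense_le)
    fix y assume y: "y < super_replication_cost \<sigma> s0 n g X"
    show "y \<le> (SUP P\<in>prob_measures n. ?E P)"
    proof (cases y)
      case (real v)
      have "\<exists>\<omega>\<in>coin_outcomes. v + gain \<delta> \<omega> \<le> X \<omega>" if "adapted \<delta>" for \<delta>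
      proof (rule ccontr)
        assume "\<not> ?thesis"
        then have "\<forall>\<omega>\<in>coin_outcomes. X \<omega> \<le> v + gain \<delta> \<omega>" by force
        then have "super_replication_cost \<sigma> s0 n g X \<le> ereal v"
          unfolding super_replication_cost_eq[OF X] using that by (intro Inf_lower) blast
        with y real show False by simp
      qed
      then obtain P where "P \<in> prob_measures n" "\<forall>\<delta>. adapted \<delta> \<longrightarrow> (\<integral>\<omega>. gain \<delta> \<omega> \<partial>P) \<le> (\<integral>\<omega>. X \<omega> \<partial>P) - v"
        using ex_minimax_measure[OF X] by blast
      then show ?thesis
        using expectation_ge_of_gain_le[OF _ X] real by (blast intro: SUP_upper2)
    qed (use y in auto)
  qed
qed

end

theorem theorem3p1:
  fixes n :: nat and \<sigma> s0 :: real
    and F :: "(real \<Rightarrow> real) \<Rightarrow> real"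
    and g :: "real \<Rightarrow> (real \<Rightarrow> real) \<Rightarrow> real \<Rightarrow> real"
  assumes "n \<ge> 1" and "\<sigma> > 0" and "s0 > 0"
    and "admissible_claim F"
    and "trading_cost g"
  shows "super_replication_cost \<sigma> s0 n g (\<lambda>\<omega>. F (stock_path \<sigma> s0 n \<omega>)) =
    (SUP P\<in>prob_measures n.
       expectation_ereal P (\<lambda>\<omega>.
         ereal (F (stock_path \<sigma> s0 n \<omega>))
         - (\<Sum>k<n. legendre g (real k / real n) (stock_path \<sigma> s0 n \<omega>)
              (real_cond_exp P (coin_filtration k) (stock \<sigma> s0 n n) \<omega> - stock \<sigma> s0 n k \<omega>))))"
proof -
  interpret market \<sigma> s0 n g using assms by unfold_locales
  have "known_at n (\<lambda>\<omega>. F (stock_path \<sigma> s0 n \<omega>))"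
    using known_at_stock_path[OF \<open>n \<ge> 1\<close>, of \<sigma> s0] by (simp add: known_at_def)
  from duality[OF this] show ?thesis unfolding drift_def .
qed

end
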